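(* Let $\mathcal{I}$ be a countable ideal in the upper semilattice $\mathcal{D}_Z$ of Ziegler degrees. Then there are sets $A, B \subseteq \omega$ such that for every $C \subseteq \omega$, $$\deg(C) \in \mathcal{I} \iff \left( C \leq_Z A \ \text{ and } \ C \leq_Z B \right).$$ (The pair $\deg(A), \deg(B)$ is called an exact pair for $\mathcal{I}$.)
   Context: Let $D_u$ be the $u$th canonical finite subset of $\omega$, let $(W_e)_{e\in\omega}$ be a standard computable enumeration of the c.e. sets, and let $\langle\cdot,\ldots,\cdot\rangle$ denote standard computable coding of tuples. For $B \subseteq \omega$ and $e,i\in\omega$ put $\Phi_e[B] = \{a : \exists u\,(\langle a,u\rangle \in W_e \wedge D_u \subseteq B)\}$ and $\Psi_i[B] = \{a : \exists u,v\,(\langle a,u,v\rangle \in W_i \wedge D_u \subseteq B \wedge D_v \cap B = \emptyset \wedge |D_v| \leq 1)\}$. For $A,B\subseteq\omega$, $A$ is Ziegler reducible to $B$, written $A \leq_Z B$, if there are $e,i$ with $A = \Phi_e[B]$ and $\omega\setminus A = \Psi_i[B]$. This is a preorder on subsets of $\omega$. Let $\equiv_Z$ be the induced equivalence relation, $\deg(A)$ the $\equiv_Z$-class of $A$, and $\mathcal{D}_Z$ the induced partial order on the set of classes (the Ziegler degrees). $\mathcal{D}_Z$ is an upper semilattice, with joins given by $A\oplus B = \{2a : a\in A\}\cup\{2b+1 : b\in B\}$, and has a least element (the class of the computable sets). An ideal of an upper semilattice is a nonempty, downward closed subset closed under binary joins. *)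

theory Defs
  imports "HOL-Library.Nat_Bijection" "HOL-Library.Countable_Set"
begin

text \<open>
  Programs for the unary partial computable functions: Kleene's schemes (basic functions,
  composition, primitive recursion, minimisation), where functions of several arguments act on
  tuples coded by the Cantor pairing function \<^const>\<open>prod_encode\<close>.
\<close>

datatype prog =
    Zero | Succ | Fst | Snd
  | Tuple prog prog
  | Comp prog prog
  | Prec prog prog
  | Mu prog

text \<open>
  The value \<^term>\<open>None\<close> means divergence.
  \<open>Prec p q\<close> computes \<open>h\<close> with \<open>h \<langle>a, 0\<rangle> = p a\<close> and
  \<open>h \<langle>a, k + 1\<rangle> = q \<langle>a, \<langle>k, h \<langle>a, k\<rangle>\<rangle>\<rangle>\<close>.
  \<open>Mu p\<close> maps \<open>n\<close> to the least \<open>k\<close> with \<open>p \<langle>n, k\<rangle> = 0\<close> such that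
  \<open>p \<langle>n, j\<rangle>\<close> converges for all \<open>j < k\<close>.
\<close>

primrec run :: "prog \<Rightarrow> nat \<Rightarrow> nat option" where
  "run Zero n = Some 0"
| "run Succ n = Some (Suc n)"
| "run Fst n = Some (fst (prod_decode n))"
| "run Snd n = Some (snd (prod_decode n))"
| "run (Tuple p q) n =
     Option.bind (run p n) (\<lambda>a. Option.bind (run q n) (\<lambda>b. Some (prod_encode (a, b))))"
| "run (Comp p q) n = Option.bind (run q n) (run p)"
| "run (Prec p q) n =
     (let (a, m) = prod_decode n in
      rec_nat (run p a)
        (\<lambda>k r. Option.bind r (\<lambda>y. run q (prod_encode (a, prod_encode (k, y))))) m)"
| "run (Mu p) n =
     (if \<exists>k. run p (prod_encode (n, k)) = Some 0 \<and>
             (\<forall>j<k. run p (prod_encode (n, j)) \<noteq> None)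
      then Some (LEAST k. run p (prod_encode (n, k)) = Some 0)
      else None)"

text \<open>
  An explicit effective Goedel numbering: 0 to 3 are the basic programs, and \<open>4 * m + r + 4\<close>
  with \<open>r < 4\<close> is the \<open>r\<close>-th compound scheme applied to the program(s) coded by \<open>m\<close>.
\<close>

function prog_of :: "nat \<Rightarrow> prog" where
  "prog_of n =
    (if n = 0 then Zero
     else if n = 1 then Succ
     else if n = 2 then Fst
     else if n = 3 then Snd
     else
       let m = (n - 4) div 4;
           a = fst (prod_decode m);
           b = snd (prod_decode m)
       in if (n - 4) mod 4 = 0 then Tuple (prog_of a) (prog_of b)
          else if (n - 4) mod 4 = 1 then Comp (prog_of a) (prog_of b)
          else if (n - 4) mod 4 = 2 then Prec (prog_of a) (prog_of b)
          else Mu (prog_of m))"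
  by auto
termination
proof (relation "measure id", goal_cases)
  have le: "fst (prod_decode m) \<le> m" "snd (prod_decode m) \<le> m" for m
    using le_prod_encode_1[of "fst (prod_decode m)" "snd (prod_decode m)"]
      le_prod_encode_2[of "snd (prod_decode m)" "fst (prod_decode m)"] by simp_all
  have lt: "(n - 4) div 4 < n" if "n \<noteq> 0" for n :: nat
    using that by linarith
  note less = le_less_trans[OF le(1) lt] le_less_trans[OF le(2) lt] lt
  { case 1 show ?case by simp }
  { case 2 then show ?case by (simp only: in_measure id_apply less not_False_eq_True) }
  { case 3 then show ?case by (simp only: in_measure id_apply less not_False_eq_True) }
  { case 4 then show ?case by (simp only: in_measure id_apply less not_False_eq_True) }
  { case 5 then show ?case by (simp only: in_measure id_apply less not_False_eq_True) }
  { case 6 then show ?case by (simp only: in_measure id_apply less not_False_eq_True) }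
  { case 7 then show ?case by (simp only: in_measure id_apply less not_False_eq_True) }
  { case 8 then show ?case by (simp only: in_measure id_apply less not_False_eq_True) }
qed

declare prog_of.simps [simp del]

lemma surj_prog_of: "surj prog_of"
proof -
  have div_mod: "(4 * m + k + 4 - 4) div 4 = m" "(4 * m + k + 4 - 4) mod 4 = k" if "k < 4"
    for m k :: nat
    using that by simp_all
  have gen: "prog_of (4 * m + k + 4) =
      (if k = 0 then Tuple (prog_of (fst (prod_decode m))) (prog_of (snd (prod_decode m)))
       else if k = 1 then Comp (prog_of (fst (prod_decode m))) (prog_of (snd (prod_decode m)))
       else if k = 2 then Prec (prog_of (fst (prod_decode m))) (prog_of (snd (prod_decode m)))
       else Mu (prog_of m))" if "k < 4" for m k
    unfolding prog_of.simps[of "4 * m + k + 4"] Let_def div_mod[OF that] by simp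
  have bin: "prog_of (4 * prod_encode (a, b) + 0 + 4) = Tuple (prog_of a) (prog_of b)"
    "prog_of (4 * prod_encode (a, b) + 1 + 4) = Comp (prog_of a) (prog_of b)"
    "prog_of (4 * prod_encode (a, b) + 2 + 4) = Prec (prog_of a) (prog_of b)" for a b
    by (subst gen; simp)+
  have mu: "prog_of (4 * m + 3 + 4) = Mu (prog_of m)" for m
    by (subst gen; simp)
  have "\<exists>n. prog_of n = p" for p
  proof (induction p)
    case Zero show ?case using prog_of.simps[of 0] by auto
  next
    case Succ show ?case using prog_of.simps[of 1] by auto
  next
    case Fst show ?case using prog_of.simps[of 2] by auto
  next
    case Snd show ?case using prog_of.simps[of 3] by auto
  next
    case (Tuple p q) then show ?case using bin(1) by blast
  next
    case (Comp p q) then show ?case using bin(2) by blast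
  next
    case (Prec p q) then show ?case using bin(3) by blast
  next
    case (Mu p) then show ?case using mu by blast
  qed
  then show ?thesis unfolding surj_def by metis
qed

definition W :: "nat \<Rightarrow> nat set" where
  "W e = {x. run (prog_of e) x \<noteq> None}"

text \<open>
  The canonical finite set with index \<open>u\<close> is \<^term>\<open>set_decode u\<close>, the set of positions of the
  binary digit 1 in \<open>u\<close>.
\<close>

definition Phi :: "nat \<Rightarrow> nat set \<Rightarrow> nat set" where
  "Phi e B = {a. \<exists>u. prod_encode (a, u) \<in> W e \<and> set_decode u \<subseteq> B}"

definition Psi :: "nat \<Rightarrow> nat set \<Rightarrow> nat set" where
  "Psi i B = {a. \<exists>u v. prod_encode (a, prod_encode (u, v)) \<in> W i \<and>
                 set_decode u \<subseteq> B \<and> set_decode v \<inter> B = {} \<and> card (set_decode v) \<le> 1}"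

definition ziegler_le :: "nat set \<Rightarrow> nat set \<Rightarrow> bool" (infix "\<le>\<^sub>Z" 50) where
  "A \<le>\<^sub>Z B \<longleftrightarrow> (\<exists>e i. A = Phi e B \<and> UNIV - A = Psi i B)"

definition ziegler_equiv :: "nat set \<Rightarrow> nat set \<Rightarrow> bool" (infix "\<equiv>\<^sub>Z" 50) where
  "A \<equiv>\<^sub>Z B \<longleftrightarrow> A \<le>\<^sub>Z B \<and> B \<le>\<^sub>Z A"

definition deg :: "nat set \<Rightarrow> nat set set" where
  "deg A = {B. A \<equiv>\<^sub>Z B}"

definition ziegler_degrees :: "nat set set set" where
  "ziegler_degrees = range deg"

definition deg_le :: "nat set set \<Rightarrow> nat set set \<Rightarrow> bool" where
  "deg_le x y \<longleftrightarrow> (\<exists>A\<in>x. \<exists>B\<in>y. A \<le>\<^sub>Z B)"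

definition set_join :: "nat set \<Rightarrow> nat set \<Rightarrow> nat set" where
  "set_join A B = {2 * a |a. a \<in> A} \<union> {2 * b + 1 |b. b \<in> B}"

text \<open>
  The join of degrees is induced by \<^const>\<open>set_join\<close> on representatives; all members of the union
  are the same degree.
\<close>

definition deg_join :: "nat set set \<Rightarrow> nat set set \<Rightarrow> nat set set" where
  "deg_join x y = (\<Union>A\<in>x. \<Union>B\<in>y. deg (set_join A B))"

definition ziegler_ideal :: "nat set set set \<Rightarrow> bool" where
  "ziegler_ideal I \<longleftrightarrow>
     I \<subseteq> ziegler_degrees \<and> I \<noteq> {} \<and>
     (\<forall>x\<in>I. \<forall>y\<in>ziegler_degrees. deg_le y x \<longrightarrow> y \<in> I) \<and>
     (\<forall>x\<in>I. \<forall>y\<in>I. deg_join x y \<in> I)"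

end

theory Submission
  imports Defs
begin

text \<open>
  Spector forcing. The sets \<open>C\<close> whose degree lies in the ideal form a countable family \<open>S\<close> closed
  under \<open>\<le>\<^sub>Z\<close> and joins. We build \<open>A\<close> and \<open>B\<close> by conditions \<open>P \<subseteq> A \<subseteq> X\<close> with \<open>P\<close> and
  \<open>X\<close> in \<open>S\<close>, coding each member of \<open>S\<close> exactly into a fresh column. For indices \<open>e, i\<close> we look for
  extensions that put some \<open>a\<close> into both \<open>\<Phi>\<^sub>e[A]\<close> and \<open>\<Psi>\<^sub>i[B]\<close>, which spoils
  \<open>\<omega> - \<Phi>\<^sub>e[A] = \<Psi>\<^sub>i[B]\<close>. If there are none and the equation holds, then \<open>a\<close> lies in
  \<open>\<Phi>\<^sub>e[A]\<close> iff some extension puts it there, and likewise for \<open>\<Psi>\<^sub>i[B]\<close>; this is positive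
  information about the upper bounds \<open>X\<close> and at most one negative question to a lower bound, so
  \<open>\<Phi>\<^sub>e[A]\<close> is in \<open>S\<close>.
\<close>

section \<open>Computable functions and c.e. sets\<close>

abbreviation pfst :: "nat \<Rightarrow> nat" where "pfst z \<equiv> fst (prod_decode z)"
abbreviation psnd :: "nat \<Rightarrow> nat" where "psnd z \<equiv> snd (prod_decode z)"

definition computable :: "(nat \<Rightarrow> nat) \<Rightarrow> bool" where
  "computable f \<longleftrightarrow> (\<exists>p. \<forall>n. run p n = Some (f n))"

named_theorems computable_intros

lemma computable_fst: "computable pfst"
  unfolding computable_def by (rule exI[of _ Fst]) simp

lemma computable_snd: "computable psnd"
  unfolding computable_def by (rule exI[of _ Snd]) simp

lemma computable_comp:
  assumes "computable f" "computable g"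
  shows "computable (\<lambda>n. f (g n))"
proof -
  obtain p q where "\<And>n. run p n = Some (f n)" "\<And>n. run q n = Some (g n)"
    using assms unfolding computable_def by auto
  then show ?thesis unfolding computable_def by (intro exI[of _ "Comp p q"]) simp
qed

lemma computable_pair [computable_intros]:
  assumes "computable f" "computable g"
  shows "computable (\<lambda>n. prod_encode (f n, g n))"
proof -
  obtain p q where "\<And>n. run p n = Some (f n)" "\<And>n. run q n = Some (g n)"
    using assms unfolding computable_def by auto
  then show ?thesis unfolding computable_def by (intro exI[of _ "Tuple p q"]) simp
qed

lemma computable_id [computable_intros]: "computable (\<lambda>n. n)"
  using computable_pair[OF computable_fst computable_snd] by simp

lemma computable_pfst [computable_intros]: "computable f \<Longrightarrow> computable (\<lambda>n. pfst (f n))"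
  by (rule computable_comp[OF computable_fst])

lemma computable_psnd [computable_intros]: "computable f \<Longrightarrow> computable (\<lambda>n. psnd (f n))"
  by (rule computable_comp[OF computable_snd])

lemma computable_Suc [computable_intros]:
  assumes "computable f" shows "computable (\<lambda>n. Suc (f n))"
proof -
  have "computable Suc" unfolding computable_def by (rule exI[of _ Succ]) simp
  then show ?thesis using assms by (rule computable_comp)
qed

lemma computable_const [computable_intros]: "computable (\<lambda>n. c)"
proof (induction c)
  case 0
  show ?case unfolding computable_def by (rule exI[of _ Zero]) simp
qed (rule computable_Suc)

text \<open>\<open>Prec\<close> passes parameter, counter and previous value to its step program as
  one code, hence the coded triple in the third hypothesis.\<close>

lemma computable_rec:
  assumes "computable f" "computable m"
    and "computable (\<lambda>z. g (pfst z) (pfst (psnd z)) (psnd (psnd z)))"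
  shows "computable (\<lambda>n. rec_nat (f n) (g n) (m n))"
proof -
  obtain p q where p: "\<And>n. run p n = Some (f n)"
    and q: "\<And>z. run q z = Some (g (pfst z) (pfst (psnd z)) (psnd (psnd z)))"
    using assms(1,3) unfolding computable_def by auto
  have "rec_nat (run p n) (\<lambda>k r. Option.bind r (\<lambda>y. run q (prod_encode (n, prod_encode (k, y))))) i
      = Some (rec_nat (f n) (g n) i)" for n i
    by (induction i) (simp_all add: p q)
  then have "run (Prec p q) z = Some (rec_nat (f (pfst z)) (g (pfst z)) (psnd z))" for z
    by (simp add: case_prod_beta)
  then have "computable (\<lambda>z. rec_nat (f (pfst z)) (g (pfst z)) (psnd z))"
    unfolding computable_def by blast
  from computable_comp[OF this computable_pair[OF computable_id assms(2)]]
  show ?thesis by simp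
qed

lemma computable_add [computable_intros]:
  assumes "computable f" "computable g" shows "computable (\<lambda>n. f n + g n)"
proof -
  have "computable (\<lambda>n. rec_nat (f n) (\<lambda>k y. Suc y) (g n))"
    by (intro computable_rec assms computable_intros)
  moreover have "rec_nat a (\<lambda>k y. Suc y) b = a + b" for a b by (induction b) auto
  ultimately show ?thesis by simp
qed

lemma computable_diff [computable_intros]:
  assumes "computable f" "computable g" shows "computable (\<lambda>n. f n - g n)"
proof -
  have pred: "computable (\<lambda>n. h n - 1)" if "computable h" for h
  proof -
    \<comment> \<open>Returning the counter yields the predecessor, with value 0 at 0.\<close>
    have "computable (\<lambda>n. rec_nat 0 (\<lambda>k y. k) (h n))"
      by (intro computable_rec that computable_intros)
    moreover have "rec_nat 0 (\<lambda>k y. k) b = b - 1" for b by (cases b) auto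
    ultimately show ?thesis by simp
  qed
  have "computable (\<lambda>n. rec_nat (f n) (\<lambda>k y. y - 1) (g n))"
    by (intro computable_rec assms pred computable_intros)
  moreover have "rec_nat a (\<lambda>k y. y - 1) b = a - b" for a b :: nat by (induction b) auto
  ultimately show ?thesis by simp
qed

lemma computable_double [computable_intros]:
  "computable f \<Longrightarrow> computable (\<lambda>n. 2 * f n)"
  unfolding mult_2 by (intro computable_intros)

lemma computable_power2 [computable_intros]:
  assumes "computable f" shows "computable (\<lambda>n. 2 ^ f n)"
proof -
  have "computable (\<lambda>n. rec_nat 1 (\<lambda>k y. 2 * y) (f n))"
    by (intro computable_rec assms computable_intros)
  moreover have "rec_nat 1 (\<lambda>k y. 2 * y) b = (2::nat) ^ b" for b by (induction b) auto
  ultimately show ?thesis by simp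
qed

lemma computable_mod2 [computable_intros]:
  assumes "computable f" shows "computable (\<lambda>n. f n mod 2)"
proof -
  have "computable (\<lambda>n. rec_nat 0 (\<lambda>k y. 1 - y) (f n))"
    by (intro computable_rec assms computable_intros)
  moreover have "rec_nat 0 (\<lambda>k y. 1 - y) b = b mod (2::nat)" for b
    by (induction b) (auto simp: mod_Suc)
  ultimately show ?thesis by simp
qed

lemma computable_div2:
  assumes "computable f" shows "computable (\<lambda>n. f n div 2)"
proof -
  \<comment> \<open>Half of a number, rounded down, counts the odd numbers below it.\<close>
  have "computable (\<lambda>n. rec_nat 0 (\<lambda>k y. y + k mod 2) (f n))"
    by (intro computable_rec assms computable_intros)
  moreover have "rec_nat 0 (\<lambda>k y. y + k mod 2) b = b div (2::nat)" for b
    by (induction b) (simp_all, presburger)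
  ultimately show ?thesis by simp
qed

lemma computable_div_power2 [computable_intros]:
  assumes "computable f" "computable g" shows "computable (\<lambda>n. f n div 2 ^ g n)"
proof -
  have "computable (\<lambda>n. rec_nat (f n) (\<lambda>k y. y div 2) (g n))"
    by (intro computable_rec assms computable_div2 computable_intros)
  moreover have "rec_nat a (\<lambda>k y. y div 2) b = a div (2::nat) ^ b" for a b
    by (induction b) (simp_all add: div_mult2_eq[symmetric] mult.commute)
  ultimately show ?thesis by simp
qed

lemma computable_if_eq [computable_intros]:
  assumes "computable f" "computable g" "computable a" "computable b"
  shows "computable (\<lambda>n. if f n = g n then a n else b n)"
proof -
  \<comment> \<open>The two truncated differences sum to 0 exactly at equality, so recursion on the
    sum is a case distinction.\<close>
  have "computable (\<lambda>n. rec_nat (a n) (\<lambda>k y. b n) ((f n - g n) + (g n - f n)))"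
    by (intro computable_rec assms computable_comp[OF assms(4)] computable_intros)
  moreover have "rec_nat x (\<lambda>k y. z) ((c - d) + (d - c)) = (if c = d then x else z)"
    for x z c d :: nat
    by (cases "(c - d) + (d - c)") auto
  ultimately show ?thesis by simp
qed

section \<open>Closure properties of the c.e. sets\<close>

definition ce :: "nat set \<Rightarrow> bool" where
  "ce V \<longleftrightarrow> (\<exists>p. V = {x. run p x \<noteq> None})"

lemma ce_iff: "ce V \<longleftrightarrow> (\<exists>e. V = W e)"
  unfolding ce_def W_def using surj_prog_of by (metis surj_def)

lemma ce_vimage:
  assumes "ce V" "computable f" shows "ce {x. f x \<in> V}"
proof -
  obtain p q where "V = {x. run p x \<noteq> None}" "\<And>n. run q n = Some (f n)"
    using assms unfolding ce_def computable_def by auto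
  then show ?thesis unfolding ce_def by (intro exI[of _ "Comp p q"]) simp
qed

lemma ce_Int:
  assumes "ce V" "ce V'" shows "ce (V \<inter> V')"
proof -
  obtain p q where "V = {x. run p x \<noteq> None}" "V' = {x. run q x \<noteq> None}"
    using assms unfolding ce_def by auto
  then show ?thesis unfolding ce_def
    by (intro exI[of _ "Tuple p q"]) (auto simp: bind_eq_None_conv)
qed

text \<open>Unbounded search computes the partial inverse of \<open>h\<close>. By injectivity the
  preimage found is the only one, so it remains to run the program for \<open>V\<close> on
  it.\<close>

lemma ce_image:
  assumes "ce V" "computable h" "inj h" shows "ce (h ` V)"
proof -
  obtain p where p: "V = {x. run p x \<noteq> None}" using assms(1) unfolding ce_def by auto
  have "computable (\<lambda>z. if pfst z = h (psnd z) then 0 else 1)"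
    by (intro computable_intros computable_comp[OF assms(2)])
  then obtain q where q: "\<And>z. run q z = Some (if pfst z = h (psnd z) then 0 else 1)"
    unfolding computable_def by blast
  have eq: "run (Mu q) n = (if \<exists>k. n = h k then Some (LEAST k. n = h k) else None)" for n
    by (simp add: q)
  have "(LEAST k. h i = h k) = i" for i
    using assms(3) by (intro Least_equality) (auto simp: inj_eq)
  then have "run (Mu q) (h i) = Some i" for i
    unfolding eq by auto
  moreover have "run (Mu q) n = None" if "n \<notin> range h" for n
    using that unfolding eq by auto
  ultimately have "run (Comp p (Mu q)) n \<noteq> None \<longleftrightarrow> n \<in> h ` V" for n
    using assms(3) by (cases "n \<in> range h") (auto simp: p inj_eq simp del: run.simps(8))
  then have "h ` V = {x. run (Comp p (Mu q)) x \<noteq> None}" by blast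
  then show ?thesis unfolding ce_def by blast
qed

text \<open>The test ignores the search counter, so \<open>Mu\<close> stops at once or searches
  forever.\<close>

lemma ce_eq:
  assumes "computable f" "computable g" shows "ce {x. f x = g x}"
proof -
  have "computable (\<lambda>z. if f (pfst z) = g (pfst z) then 0 else 1)"
    by (intro computable_intros computable_comp[OF assms(1)] computable_comp[OF assms(2)])
  then obtain q where q: "\<And>z. run q z = Some (if f (pfst z) = g (pfst z) then 0 else 1)"
    unfolding computable_def by blast
  have "{x. f x = g x} = {x. run (Mu q) x \<noteq> None}"
    by (auto simp: q)
  then show ?thesis unfolding ce_def by blast
qed

section \<open>Ziegler reductions\<close>

lemma ziegler_leI:
  assumes "ce V" "ce V'"
    and "C = {a. \<exists>u. prod_encode (a, u) \<in> V \<and> set_decode u \<subseteq> B}"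
    and "UNIV - C = {a. \<exists>u v. prod_encode (a, prod_encode (u, v)) \<in> V' \<and>
        set_decode u \<subseteq> B \<and> set_decode v \<inter> B = {} \<and> card (set_decode v) \<le> 1}"
  shows "C \<le>\<^sub>Z B"
  using assms unfolding ziegler_le_def Phi_def Psi_def ce_iff by blast

lemma set_decode_power2 [simp]: "set_decode (2 ^ n) = {n}"
  using set_encode_inverse[of "{n}"] by (simp add: set_encode_def)

text \<open>The axioms for \<open>x\<close> query only \<open>f x\<close>: positively for
  membership, negatively for non-membership, with 0 as the index of the empty positive part.\<close>

lemma many_one_ziegler_le:
  assumes "computable f" "\<And>x. x \<in> C \<longleftrightarrow> f x \<in> B"
  shows "C \<le>\<^sub>Z B"
proof (rule ziegler_leI)
  show "ce {z. psnd z = 2 ^ f (pfst z)}"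
    by (intro ce_eq computable_intros computable_comp[OF assms(1)])
  show "ce {z. psnd z = prod_encode (0, 2 ^ f (pfst z))}"
    by (intro ce_eq computable_intros computable_comp[OF assms(1)])
qed (auto simp: assms(2) prod_encode_eq)

lemma ziegler_le_refl: "A \<le>\<^sub>Z A"
  by (rule many_one_ziegler_le[OF computable_id]) simp

text \<open>The axioms impose nothing on the indices, so 0, the index of the empty set, serves for
  every query and no information on \<open>B\<close> is required.\<close>

lemma computable_ziegler_le:
  assumes "computable c" shows "{a. c a = 0} \<le>\<^sub>Z B"
proof (rule ziegler_leI)
  show "ce {z. c (pfst z) = 0}"
    by (intro ce_eq computable_intros computable_comp[OF assms(1)])
  show "ce {z. 1 - c (pfst z) = 0}"
    by (intro ce_eq computable_intros computable_comp[OF assms(1)])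
qed (auto intro!: exI[of _ 0])

lemma ce_mem_set_decode: "computable f \<Longrightarrow> computable g \<Longrightarrow> ce {z. f z \<in> set_decode (g z)}"
  and ce_not_mem_set_decode: "computable f \<Longrightarrow> computable g \<Longrightarrow> ce {z. f z \<notin> set_decode (g z)}"
proof -
  assume *: "computable f" "computable g"
  have "ce {z. g z div 2 ^ f z mod 2 = 1}" "ce {z. g z div 2 ^ f z mod 2 = 0}"
    by (intro ce_eq computable_intros *)+
  then show "ce {z. f z \<in> set_decode (g z)}" "ce {z. f z \<notin> set_decode (g z)}"
    by (simp_all add: set_decode_def odd_iff_mod_2_eq_one even_iff_mod_2_eq_zero)
qed

text \<open>To see that \<open>D_u\<close> is not included in \<open>Y\<close>, one negative query suffices.\<close>

lemma powerset_ziegler_le: "{u. set_decode u \<subseteq> Y} \<le>\<^sub>Z Y"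
proof (rule ziegler_leI)
  show "ce {z. pfst z = psnd z}"
    by (intro ce_eq computable_intros)
  let ?h = "\<lambda>z. prod_encode (pfst z, prod_encode (0, 2 ^ psnd z))"
  have "inj ?h"
    by (rule injI) (simp add: prod_encode_eq, metis prod.collapse prod_decode_eq)
  then show "ce (?h ` {z. psnd z \<in> set_decode (pfst z)})"
    by (intro ce_image ce_mem_set_decode computable_intros)
  have "prod_encode (a, prod_encode (u, v)) \<in> ?h ` {z. psnd z \<in> set_decode (pfst z)} \<longleftrightarrow>
      u = 0 \<and> (\<exists>y \<in> set_decode a. v = 2 ^ y)" for a u v
    by (auto simp: prod_encode_eq image_iff) (metis fst_conv snd_conv prod_encode_inverse)
  then show "UNIV - {u. set_decode u \<subseteq> Y} = {a. \<exists>u v.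
      prod_encode (a, prod_encode (u, v)) \<in> ?h ` {z. psnd z \<in> set_decode (pfst z)} \<and>
      set_decode u \<subseteq> Y \<and> set_decode v \<inter> Y = {} \<and> card (set_decode v) \<le> 1}"
    by auto
qed auto

lemma even_in_set_join [simp]: "2 * x \<in> set_join A B \<longleftrightarrow> x \<in> A"
  and odd_in_set_join [simp]: "Suc (2 * x) \<in> set_join A B \<longleftrightarrow> x \<in> B"
  unfolding set_join_def by (auto, presburger+)


text \<open>Sets with at most one element, coded so that \<open>0\<close> stands for the empty set and
  \<open>q + 1\<close> for \<open>{q}\<close>.\<close>

definition single_index :: "nat \<Rightarrow> nat" where
  "single_index t = (if t = 0 then 0 else 2 ^ (t - 1))"

lemma set_decode_single_index [simp]: "set_decode (single_index t) = {q. t = Suc q}"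
  unfolding single_index_def by (cases t) auto

text \<open>Turns the negative part of an axiom of \<open>Psi\<close> into a number
  \<open>t\<close>, about which a single query can be asked.\<close>

lemma card_le_1_single_index:
  assumes "card (set_decode v) \<le> 1" shows "\<exists>t. v = single_index t"
proof (cases "set_decode v = {}")
  case True
  then have "v = single_index 0"
    by (metis set_decode_inverse set_encode_empty single_index_def)
  then show ?thesis ..
next
  case False
  then have "card (set_decode v) = 1"
    using assms by (simp add: le_Suc_eq)
  then obtain q where "set_decode v = {q}"
    by (auto simp: card_1_singleton_iff)
  then have "v = single_index (Suc q)"
    by (metis set_decode_inverse set_decode_power2 single_index_def diff_Suc_1 nat.distinct(1))
  then show ?thesis ..
qed

lemma computable_single_index [computable_intros]:
  "computable f \<Longrightarrow> computable (\<lambda>n. single_index (f n))"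
  unfolding single_index_def by (intro computable_intros)

section \<open>Forcing with pairs of members of an ideal\<close>

text \<open>The closure conditions of an ideal, read on sets instead of degrees.\<close>

locale ziegler_set_ideal =
  fixes S :: "nat set set"
  assumes down: "C \<in> S \<Longrightarrow> D \<le>\<^sub>Z C \<Longrightarrow> D \<in> S"
    and join: "C \<in> S \<Longrightarrow> D \<in> S \<Longrightarrow> set_join C D \<in> S"
    and nonempty: "S \<noteq> {}"
begin

lemma many_one:
  assumes "B \<in> S" "computable f" "\<And>x. x \<in> C \<longleftrightarrow> f x \<in> B"
  shows "C \<in> S"
  using assms down many_one_ziegler_le by blast

text \<open>Adding \<open>z\<close> is a many-one reduction that redirects \<open>z\<close> to a
  fixed element of \<open>P\<close>. This is why conditions have nonempty lower bounds and, dually,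
  upper bounds other than \<omega>.\<close>

lemma Un_finite_mem:
  assumes "finite F" "P \<in> S" "P \<noteq> {}" shows "P \<union> F \<in> S"
  using assms(1)
proof induction
  case (insert z F)
  obtain p where "p \<in> P" using assms(3) by blast
  then show ?case
    by (intro many_one[OF insert.IH, of "\<lambda>y. if y = z then p else y"] computable_intros) auto
qed (use assms in simp)

lemma Diff_finite_mem:
  assumes "finite F" "X \<in> S" "X \<noteq> UNIV" shows "X - F \<in> S"
  using assms(1)
proof induction
  case (insert z F)
  obtain x where "x \<notin> X" using assms(3) by blast
  then show ?case
    by (intro many_one[OF insert.IH, of "\<lambda>y. if y = z then x else y"] computable_intros) auto
qed (use assms in simp)

lemma replace_column_mem:
  assumes "P \<in> S" "C \<in> S"
  shows "{z. if pfst z = k then psnd z \<in> C else z \<in> P} \<in> S"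
proof (rule many_one[OF join[OF assms]])
  show "computable (\<lambda>z. if pfst z = k then Suc (2 * psnd z) else 2 * z)"
    by (intro computable_intros)
qed auto

text \<open>A condition \<open>(P, X)\<close> stands for the sets \<open>A\<close> with \<open>P \<subseteq> A \<subseteq> X\<close>; all but finitely many
  columns \<open>{\<langle>j, x\<rangle> : x \<in> \<omega>}\<close> of \<open>A\<close> are left free.\<close>

definition condition :: "nat set \<Rightarrow> nat set \<Rightarrow> bool" where
  "condition P X \<longleftrightarrow> P \<in> S \<and> X \<in> S \<and> P \<subseteq> X \<and> P \<noteq> {} \<and> X \<noteq> UNIV \<and>
     (\<exists>k. \<forall>j\<ge>k. \<forall>x. prod_encode (j, x) \<in> X - P)"

lemma condition_exists: "\<exists>P X. condition P X"
proof -
  obtain E where E: "E \<in> S" using nonempty by blast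
  have "{a. a = 0} \<in> S"
    using down[OF E computable_ziegler_le[OF computable_id]] by simp
  \<comment> \<open>The zero set of this function is the upper bound.\<close>
  moreover have "computable (\<lambda>a. if a = 1 then 1 else 0)"
    by (intro computable_intros)
  from down[OF E computable_ziegler_le[OF this]] have "{a. a \<noteq> 1} \<in> S"
    by (simp split: if_splits)
  moreover have "prod_encode (j, x) \<in> {a. a \<noteq> 1} - {a. a = 0}" if "j \<ge> 2" for j x
    using that le_prod_encode_1[of j x] by auto
  ultimately have "condition {a. a = 0} {a. a \<noteq> 1}"
    unfolding condition_def by (auto intro!: exI[of _ 2])
  then show ?thesis by blast
qed

text \<open>Since \<open>prod_encode (j, x)\<close> is at least \<open>j\<close>, a finite set meets
  only finitely many columns, and almost all columns stay free. The disjointness hypotheses keep the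
  lower bound inside the upper one.\<close>

lemma condition_finite:
  assumes "condition P X" "finite F" "finite G" "F \<subseteq> X" "G \<inter> P = {}" "F \<inter> G = {}"
  shows "condition (P \<union> F) (X - G)"
proof -
  obtain k where k: "\<And>j x. j \<ge> k \<Longrightarrow> prod_encode (j, x) \<in> X - P"
    using assms(1) unfolding condition_def by blast
  have "finite (F \<union> G)" using assms by simp
  then obtain m where m: "\<And>z. z \<in> F \<union> G \<Longrightarrow> z < m"
    unfolding finite_nat_set_iff_bounded by blast
  have "prod_encode (j, x) \<in> (X - G) - (P \<union> F)" if "j \<ge> max k m" for j x
    using that k[of j x] m[of "prod_encode (j, x)"] le_prod_encode_1[of j x] by auto
  then show ?thesis
    using assms unfolding condition_def
    by (intro conjI Un_finite_mem Diff_finite_mem exI[of _ "max k m"]) auto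
qed

section \<open>Extending conditions: coding and deciding\<close>

definition extends :: "nat set \<times> nat set \<Rightarrow> nat set \<times> nat set \<Rightarrow> bool" where
  "extends p' p \<longleftrightarrow> fst p \<subseteq> fst p' \<and> snd p' \<subseteq> snd p"

text \<open>As both bounds agree on the column, every set between them carries \<open>C\<close>
  there.\<close>

definition codes :: "nat set \<Rightarrow> nat set \<times> nat set \<Rightarrow> bool" where
  "codes C p \<longleftrightarrow> (\<exists>k. \<forall>x. (prod_encode (k, x) \<in> fst p \<longleftrightarrow> x \<in> C) \<and>
      (prod_encode (k, x) \<in> snd p \<longleftrightarrow> x \<in> C))"

text \<open>A free column misses \<open>P\<close> and lies inside \<open>X\<close>, so writing
  \<open>C\<close> into it in both bounds only enlarges \<open>P\<close> and shrinks
  \<open>X\<close>.\<close>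

lemma code_step:
  assumes "condition P X" "C \<in> S"
  shows "\<exists>P' X'. condition P' X' \<and> extends (P', X') (P, X) \<and> codes C (P', X')"
proof -
  obtain k where k: "\<And>j x. j \<ge> k \<Longrightarrow> prod_encode (j, x) \<in> X - P"
    using assms(1) unfolding condition_def by blast
  let ?ext = "\<lambda>P. {z. if pfst z = k then psnd z \<in> C else z \<in> P}"
  have column: "z \<in> X - P" if "pfst z = k" for z
    using k[of k "psnd z"] that by (metis order_refl prod.collapse prod_decode_inverse)
  have "condition (?ext P) (?ext X)"
    unfolding condition_def
  proof (intro conjI)
    show "?ext P \<in> S" "?ext X \<in> S"
      using assms unfolding condition_def by (blast intro: replace_column_mem)+
    \<comment> \<open>Neither witness lies in column \<open>k\<close>, since that column is part of
      \<open>X - P\<close>; both survive the overwriting.\<close>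
    obtain p x where "p \<in> P" "x \<notin> X" and sub: "P \<subseteq> X"
      using assms(1) unfolding condition_def by blast
    then have "p \<in> ?ext P" "x \<notin> ?ext X" using column by auto
    then show "?ext P \<noteq> {}" "?ext X \<noteq> UNIV" by blast+
    show "?ext P \<subseteq> ?ext X" using sub by auto
    show "\<exists>k'. \<forall>j\<ge>k'. \<forall>x. prod_encode (j, x) \<in> ?ext X - ?ext P"
      using k by (auto intro!: exI[of _ "Suc k"])
  qed
  moreover have "extends (?ext P, ?ext X) (P, X)"
    using column unfolding extends_def by auto
  moreover have "codes C (?ext P, ?ext X)"
    unfolding codes_def by (auto intro!: exI[of _ k])
  ultimately show ?thesis by blast
qed

text \<open>To avoid operating on canonical indices, inclusions of finite sets in \<open>X\<close> and \<open>Y\<close> are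
  replaced by queries about single elements of \<open>{u. D_u \<subseteq> X}\<close> and \<open>{u. D_u \<subseteq> Y}\<close>.\<close>

lemma no_split_mem:
  assumes "X \<in> S" "Y \<in> S" "Q \<in> S" "Q \<noteq> UNIV"
    and "A \<subseteq> X" "Q \<subseteq> B" "B \<subseteq> Y" and compl: "UNIV - Phi e A = Psi i B"
    and no_split: "\<And>a u u' v. prod_encode (a, u) \<in> W e \<Longrightarrow> set_decode u \<subseteq> X \<Longrightarrow>
      prod_encode (a, prod_encode (u', v)) \<in> W i \<Longrightarrow> set_decode u' \<subseteq> Y \<Longrightarrow>
      set_decode v \<inter> Q = {} \<Longrightarrow> set_decode u' \<inter> set_decode v = {} \<Longrightarrow>
      card (set_decode v) \<le> 1 \<Longrightarrow> False"
  shows "Phi e A \<in> S"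
proof -
  let ?X = "{u. set_decode u \<subseteq> X}" and ?Y = "{u. set_decode u \<subseteq> Y}"
  \<comment> \<open>\<open>t\<close> is in \<open>?Q\<close> iff the set coded by \<open>t\<close>
    meets \<open>Q\<close>; the code 0 of the empty set never does.\<close>
  let ?Q = "{t. t \<noteq> 0 \<and> t - 1 \<in> Q}"
  let ?E = "set_join ?X (set_join ?Y ?Q)"
  obtain q where q: "q \<notin> Q" using assms(4) by blast
  have "?Q \<in> S"
    by (rule many_one[OF \<open>Q \<in> S\<close>, of "\<lambda>t. if t = 0 then q else t - 1"])
      (intro computable_intros, simp add: q)
  then have E: "?E \<in> S"
    using assms(1,2) by (intro join) (auto intro: down powerset_ziegler_le)
  \<comment> \<open>The query whether \<open>D_u\<close> lies in \<open>X\<close> becomes the query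
    about the single element \<open>2 * u\<close> of \<open>?E\<close>.\<close>
  let ?g = "\<lambda>z. prod_encode (pfst z, 2 ^ (2 * psnd z))"
  have "inj ?g"
    by (rule injI) (simp add: prod_encode_eq, metis prod.collapse prod_decode_eq)
  then have ceg: "ce (?g ` W e)"
    by (intro ce_image computable_intros) (auto simp: ce_iff)
  \<comment> \<open>In \<open>?E\<close>, the element 4u + 1 stands for \<open>u\<close> in
    \<open>?Y\<close> and 4t + 3 for \<open>t\<close> in \<open>?Q\<close>. The second part of
    \<open>?V\<close> discards axioms whose positive and negative parts overlap.\<close>
  let ?h = "\<lambda>z. prod_encode (pfst z, prod_encode (2 ^ Suc (2 * (2 * pfst (psnd z))),
      2 ^ Suc (2 * Suc (2 * psnd (psnd z)))))"
  let ?V = "{z. prod_encode (pfst z, prod_encode (pfst (psnd z), single_index (psnd (psnd z))))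
      \<in> W i} \<inter> {z. psnd (psnd z) \<notin> set_decode (2 * pfst (psnd z))}"
  have "inj ?h"
    by (rule injI) (simp add: prod_encode_eq, metis prod.collapse prod_decode_eq)
  then have ceh: "ce (?h ` ?V)"
    by (intro ce_image ce_Int ce_vimage ce_not_mem_set_decode computable_intros)
      (auto simp: ce_iff)
  have mem_g: "prod_encode (a, w) \<in> ?g ` W e \<longleftrightarrow>
      (\<exists>u. w = 2 ^ (2 * u) \<and> prod_encode (a, u) \<in> W e)" for a w
    by (auto simp: prod_encode_eq image_iff)
      (metis fst_conv snd_conv prod_encode_inverse prod.collapse prod_decode_inverse)+
  have mem_h: "prod_encode (a, prod_encode (w, w')) \<in> ?h ` ?V \<longleftrightarrow>
      (\<exists>u t. w = 2 ^ Suc (2 * (2 * u)) \<and> w' = 2 ^ Suc (2 * Suc (2 * t)) \<and>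
        prod_encode (a, prod_encode (u, single_index t)) \<in> W i \<and> t \<notin> set_decode (2 * u))"
    (is "?L \<longleftrightarrow> ?R") for a w w'
  proof
    assume ?L then show ?R by (auto simp: prod_encode_eq simp del: power_Suc)
  next
    assume ?R
    then obtain u t where ut: "w = 2 ^ Suc (2 * (2 * u))" "w' = 2 ^ Suc (2 * Suc (2 * t))"
      "prod_encode (a, prod_encode (u, single_index t)) \<in> W i" "t \<notin> set_decode (2 * u)"
      by blast
    show ?L
      by (rule image_eqI[of _ _ "prod_encode (a, prod_encode (u, t))"]) (use ut in simp_all)
  qed
  \<comment> \<open>Doubling shifts binary digits by one place, matching the shift in
    \<open>single_index\<close>.\<close>
  have disj: "t \<notin> set_decode (2 * u) \<longleftrightarrow> set_decode u \<inter> set_decode (single_index t) = {}" for t u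
    by (cases t) auto
  \<comment> \<open>Replacing \<open>A\<close> by \<open>X\<close> adds no element: a new
    \<open>a\<close> would be in \<open>Psi i B\<close> by \<open>compl\<close>, and its two axioms
    would form a split.\<close>
  have Phi: "Phi e A = {a. \<exists>u. prod_encode (a, u) \<in> W e \<and> set_decode u \<subseteq> X}" (is "_ = ?C")
  proof
    show "Phi e A \<subseteq> ?C" using \<open>A \<subseteq> X\<close> unfolding Phi_def by blast
    show "?C \<subseteq> Phi e A"
    proof (clarify, rule ccontr)
      fix a u assume u: "prod_encode (a, u) \<in> W e" "set_decode u \<subseteq> X" "a \<notin> Phi e A"
      then obtain u' v where "prod_encode (a, prod_encode (u', v)) \<in> W i"
        "set_decode u' \<subseteq> B" "set_decode v \<inter> B = {}" "card (set_decode v) \<le> 1"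
        using compl unfolding Psi_def by blast
      with u show False using no_split[of a u u' v] assms(6,7) by blast
    qed
  qed
  \<comment> \<open>Likewise \<open>B\<close> may be relaxed to \<open>Y\<close> in positive and to
    \<open>Q\<close> in negative queries: an \<open>a\<close> gained in this way would be in
    \<open>Phi e A\<close> and again yield a split.\<close>
  have Psi: "UNIV - Phi e A = {a. \<exists>u t. prod_encode (a, prod_encode (u, single_index t)) \<in> W i \<and>
      t \<notin> set_decode (2 * u) \<and> set_decode u \<subseteq> Y \<and> t \<notin> ?Q}" (is "_ = ?D")
  proof
    show "UNIV - Phi e A \<subseteq> ?D"
    proof
      fix a assume "a \<in> UNIV - Phi e A"
      then obtain u v where uv: "prod_encode (a, prod_encode (u, v)) \<in> W i"
        "set_decode u \<subseteq> B" "set_decode v \<inter> B = {}" "card (set_decode v) \<le> 1"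
        unfolding compl Psi_def by blast
      then obtain t where t: "v = single_index t" using card_le_1_single_index by blast
      have "set_decode u \<inter> set_decode v = {}" using uv by blast
      moreover have "t \<notin> ?Q" using uv(3) \<open>Q \<subseteq> B\<close> unfolding t by (cases t) auto
      ultimately show "a \<in> ?D" using uv \<open>B \<subseteq> Y\<close> unfolding t disj[symmetric] by blast
    qed
    show "?D \<subseteq> UNIV - Phi e A"
    proof (rule subsetI, rule DiffI[OF UNIV_I], rule notI)
      fix a assume "a \<in> ?D" and a: "a \<in> Phi e A"
      then obtain u t where *: "prod_encode (a, prod_encode (u, single_index t)) \<in> W i"
        "t \<notin> set_decode (2 * u)" "set_decode u \<subseteq> Y" "t \<notin> ?Q"
        by blast
      obtain u' where "prod_encode (a, u') \<in> W e" "set_decode u' \<subseteq> X"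
        using a unfolding Phi by blast
      moreover have "set_decode (single_index t) \<inter> Q = {}" using *(4) by auto
      moreover have "card (set_decode (single_index t)) \<le> 1" by (cases t) auto
      ultimately show False
        using no_split[of a u' u "single_index t"] * unfolding disj by blast
    qed
  qed
  have "Phi e A \<le>\<^sub>Z ?E"
  proof (rule ziegler_leI[OF ceg ceh])
    show "Phi e A = {a. \<exists>u. prod_encode (a, u) \<in> ?g ` W e \<and> set_decode u \<subseteq> ?E}"
      unfolding Phi mem_g by auto
    have "set_decode (2 ^ Suc (2 * (2 * u))) \<subseteq> ?E \<longleftrightarrow> set_decode u \<subseteq> Y"
      "set_decode (2 ^ Suc (2 * Suc (2 * t))) \<inter> ?E = {} \<longleftrightarrow> t \<notin> ?Q"
      "card (set_decode (2 ^ Suc (2 * Suc (2 * t)))) \<le> 1" for u t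
      by (simp_all only: set_decode_power2 insert_subset empty_subsetI insert_disjoint
          Int_empty_left even_in_set_join odd_in_set_join mem_Collect_eq card.insert finite.emptyI simp_thms
          card.empty empty_iff One_nat_def order_refl)
    then show "UNIV - Phi e A = {a. \<exists>u v. prod_encode (a, prod_encode (u, v)) \<in> ?h ` ?V \<and>
        set_decode u \<subseteq> ?E \<and> set_decode v \<inter> ?E = {} \<and> card (set_decode v) \<le> 1}"
      unfolding Psi mem_h by blast
  qed
  then show ?thesis by (rule down[OF E])
qed

text \<open>Quantifying over all sets between the bounds makes a decision persist under extension
  and apply to the limit sets.\<close>

definition decides :: "nat \<Rightarrow> nat \<Rightarrow> nat set \<times> nat set \<Rightarrow> nat set \<times> nat set \<Rightarrow> bool" where
  "decides e i p q \<longleftrightarrow> (\<forall>A B. fst p \<subseteq> A \<longrightarrow> A \<subseteq> snd p \<longrightarrow> fst q \<subseteq> B \<longrightarrow> B \<subseteq> snd q \<longrightarrow>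
      UNIV - Phi e A = Psi i B \<longrightarrow> Phi e A \<in> S)"

text \<open>If a split exists, adding \<open>D_u\<close> to \<open>P\<close> and \<open>D_u'\<close>
  to \<open>Q\<close> and removing \<open>D_v\<close> from \<open>Y\<close> forces \<open>a\<close>
  into both sets, so the equation fails. Otherwise the given conditions already decide, by
  \<open>no_split_mem\<close>.\<close>

lemma decide_step:
  assumes "condition P X" "condition Q Y"
  shows "\<exists>P' X' Q' Y'. condition P' X' \<and> condition Q' Y' \<and> extends (P', X') (P, X) \<and>
    extends (Q', Y') (Q, Y) \<and> decides e i (P', X') (Q', Y')"
proof (cases "\<exists>a u u' v. prod_encode (a, u) \<in> W e \<and> set_decode u \<subseteq> X \<and>
      prod_encode (a, prod_encode (u', v)) \<in> W i \<and> set_decode u' \<subseteq> Y \<and>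
      set_decode v \<inter> Q = {} \<and> set_decode u' \<inter> set_decode v = {} \<and> card (set_decode v) \<le> 1")
  case True
  then obtain a u u' v where *: "prod_encode (a, u) \<in> W e" "set_decode u \<subseteq> X"
      "prod_encode (a, prod_encode (u', v)) \<in> W i" "set_decode u' \<subseteq> Y"
      "set_decode v \<inter> Q = {}" "set_decode u' \<inter> set_decode v = {}" "card (set_decode v) \<le> 1"
    by blast
  have "condition (P \<union> set_decode u) (X - {})"
    using * by (intro condition_finite assms) auto
  moreover have "condition (Q \<union> set_decode u') (Y - set_decode v)"
    using * by (intro condition_finite assms) auto
  moreover have "decides e i (P \<union> set_decode u, X - {}) (Q \<union> set_decode u', Y - set_decode v)"
    unfolding decides_def
  proof (intro allI impI)
    fix A B
    assume AB: "fst (P \<union> set_decode u, X - {}) \<subseteq> A"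
      "fst (Q \<union> set_decode u', Y - set_decode v) \<subseteq> B"
      "B \<subseteq> snd (Q \<union> set_decode u', Y - set_decode v)" "UNIV - Phi e A = Psi i B"
    have "a \<in> Phi e A" using * AB unfolding Phi_def by auto
    moreover have "a \<in> Psi i B"
      unfolding Psi_def using *(3,7) AB(2,3)
      by (intro CollectI exI[of _ u'] exI[of _ v]) auto
    ultimately show "Phi e A \<in> S" using AB(4) by blast
  qed
  ultimately show ?thesis
    unfolding extends_def by (intro exI conjI) auto
next
  case False
  have "X \<in> S" "Y \<in> S" "Q \<in> S" "Q \<noteq> UNIV"
    using assms unfolding condition_def by auto
  then have "decides e i (P, X) (Q, Y)"
    unfolding decides_def fst_conv snd_conv using False
    by (intro allI impI, elim no_split_mem[of X Y Q, rotated 7]) blast+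
  then show ?thesis using assms unfolding extends_def by auto
qed

lemma extends_trans: "extends p q \<Longrightarrow> extends q r \<Longrightarrow> extends p r"
  unfolding extends_def by auto

lemma step:
  assumes "condition P X" "condition Q Y" "C \<in> S"
  shows "\<exists>P' X' Q' Y'. condition P' X' \<and> condition Q' Y' \<and> extends (P', X') (P, X) \<and>
    extends (Q', Y') (Q, Y) \<and> codes C (P', X') \<and> codes C (Q', Y') \<and> decides e i (P', X') (Q', Y')"
proof -
  obtain P1 X1 Q1 Y1 where 1: "condition P1 X1" "condition Q1 Y1" "extends (P1, X1) (P, X)"
    "extends (Q1, Y1) (Q, Y)" "decides e i (P1, X1) (Q1, Y1)"
    using decide_step[OF assms(1,2)] by blast
  obtain P2 X2 where 2: "condition P2 X2" "extends (P2, X2) (P1, X1)" "codes C (P2, X2)"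
    using code_step[OF 1(1) assms(3)] by blast
  obtain Q2 Y2 where 3: "condition Q2 Y2" "extends (Q2, Y2) (Q1, Y1)" "codes C (Q2, Y2)"
    using code_step[OF 1(2) assms(3)] by blast
  have "decides e i (P2, X2) (Q2, Y2)"
    using 1(5) 2(2) 3(2) unfolding decides_def extends_def by (meson subset_trans)
  then show ?thesis using 1 2 3 by (meson extends_trans)
qed

lemma codes_ziegler_le:
  assumes "codes C p" "fst p \<subseteq> A" "A \<subseteq> snd p" shows "C \<le>\<^sub>Z A"
proof -
  obtain k where "\<And>x. prod_encode (k, x) \<in> fst p \<longleftrightarrow> x \<in> C"
      "\<And>x. prod_encode (k, x) \<in> snd p \<longleftrightarrow> x \<in> C"
    using assms(1) unfolding codes_def by blast
  then have "x \<in> C \<longleftrightarrow> prod_encode (k, x) \<in> A" for x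
    using assms(2,3) by blast
  moreover have "computable (\<lambda>x. prod_encode (k, x))"
    by (intro computable_intros)
  ultimately show ?thesis using many_one_ziegler_le by blast
qed

section \<open>The limit of the construction\<close>

lemma extends_limit:
  assumes "\<And>n. extends (p (Suc n)) (p n)" "\<And>n. fst (p n) \<subseteq> snd (p n)"
  shows "fst (p n) \<subseteq> (\<Union>n. fst (p n))" "(\<Union>n. fst (p n)) \<subseteq> snd (p n)"
proof -
  have mono: "extends (p n) (p m)" if "m \<le> n" for m n
    using that
    by (induction rule: dec_induct) (auto intro: extends_trans[OF assms(1)], simp add: extends_def)
  \<comment> \<open>Pass through the later of the two stages, whose lower bound lies inside its
    upper bound.\<close>
  have "fst (p m) \<subseteq> snd (p n)" for m
    using mono[of m n] mono[of n m] assms(2)[of n] assms(2)[of m] nat_le_linear[of m n]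
    unfolding extends_def by blast
  then show "(\<Union>n. fst (p n)) \<subseteq> snd (p n)" by blast
qed blast

theorem exact_pair:
  assumes "countable S"
  shows "\<exists>A B. \<forall>C. C \<in> S \<longleftrightarrow> C \<le>\<^sub>Z A \<and> C \<le>\<^sub>Z B"
proof -
  define c where "c = from_nat_into S"
  have c: "c n \<in> S" for n unfolding c_def using nonempty by (rule from_nat_into)
  define ok where "ok = (\<lambda>s. condition (fst (fst s)) (snd (fst s)) \<and>
      condition (fst (snd s)) (snd (snd s)))"
  \<comment> \<open>Stage \<open>n\<close> codes the \<open>n\<close>th member of \<open>S\<close>
    and treats the pair of indices coded by \<open>n\<close>; every pair occurs.\<close>
  define R where "R = (\<lambda>n s s'. extends (fst s') (fst s) \<and> extends (snd s') (snd s) \<and>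
      codes (c n) (fst s') \<and> codes (c n) (snd s') \<and>
      decides (pfst n) (psnd n) (fst s') (snd s'))"
  have "\<exists>s. \<forall>n. ok (s n) \<and> R n (s n) (s (Suc n))"
  proof (rule dependent_nat_choice)
    show "\<exists>s. ok s" using condition_exists unfolding ok_def by auto
    show "\<exists>s'. ok s' \<and> R n s s'" if "ok s" for s n
      using step[OF _ _ c] that unfolding ok_def R_def
      by (metis fst_conv snd_conv prod.collapse)
  qed
  then obtain s where ok: "\<And>n. ok (s n)" and R: "\<And>n. R n (s n) (s (Suc n))" by blast
  define A where "A = (\<Union>n. fst (fst (s n)))"
  define B where "B = (\<Union>n. fst (snd (s n)))"
  have A: "fst (fst (s n)) \<subseteq> A" "A \<subseteq> snd (fst (s n))" for n
    using extends_limit[of "\<lambda>n. fst (s n)" n] ok R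
    unfolding A_def ok_def R_def condition_def by auto
  have B: "fst (snd (s n)) \<subseteq> B" "B \<subseteq> snd (snd (s n))" for n
    using extends_limit[of "\<lambda>n. snd (s n)" n] ok R
    unfolding B_def ok_def R_def condition_def by auto
  have "C \<le>\<^sub>Z A" "C \<le>\<^sub>Z B" if C: "C \<in> S" for C
  proof -
    obtain n where "C = c n"
      using from_nat_into_surj[OF assms C] unfolding c_def by metis
    then have "codes C (fst (s (Suc n)))" "codes C (snd (s (Suc n)))"
      using R[of n] unfolding R_def by auto
    then show "C \<le>\<^sub>Z A" "C \<le>\<^sub>Z B"
      by - (erule codes_ziegler_le[OF _ A], erule codes_ziegler_le[OF _ B])
  qed
  moreover have "C \<in> S" if reducible: "C \<le>\<^sub>Z A" "C \<le>\<^sub>Z B" for C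
  proof -
    obtain e where e: "C = Phi e A"
      using reducible(1) unfolding ziegler_le_def by (elim exE conjE)
    obtain i where i: "UNIV - C = Psi i B"
      using reducible(2) unfolding ziegler_le_def by (elim exE conjE)
    \<comment> \<open>The positive half of one reduction and the negative half of the other give the
      equation treated at this stage.\<close>
    have "decides e i (fst (s (Suc (prod_encode (e, i))))) (snd (s (Suc (prod_encode (e, i)))))"
      using R[of "prod_encode (e, i)"] unfolding R_def by simp
    from this[unfolded decides_def, rule_format, OF A B] show ?thesis
      using i unfolding e .
  qed
  ultimately show ?thesis by blast
qed

end

section \<open>From ideals of degrees to families of sets\<close>

lemma mem_deg_self: "A \<in> deg A"
  unfolding deg_def ziegler_equiv_def by (simp add: ziegler_le_refl)

lemma ziegler_set_ideal_of_ideal: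
  assumes "ziegler_ideal I" shows "ziegler_set_ideal {C. deg C \<in> I}"
proof
  have down: "deg D \<in> I" if "deg C \<in> I" "D \<le>\<^sub>Z C" for C D
    using assms that mem_deg_self[of C] mem_deg_self[of D]
    unfolding ziegler_ideal_def deg_le_def ziegler_degrees_def by blast
  then show "D \<in> {C. deg C \<in> I}" if "C \<in> {C. deg C \<in> I}" "D \<le>\<^sub>Z C" for C D
    using that by blast
  show "set_join C D \<in> {C. deg C \<in> I}" if "C \<in> {C. deg C \<in> I}" "D \<in> {C. deg C \<in> I}" for C D
  proof -
    have J: "deg_join (deg C) (deg D) \<in> I"
      using assms that unfolding ziegler_ideal_def by blast
    \<comment> \<open>\<open>deg_join\<close> is a union over representatives; being in
      \<open>I\<close>, it is a single degree, and \<open>set_join C D\<close> belongs to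
      it.\<close>
    then obtain E where E: "deg_join (deg C) (deg D) = deg E"
      using assms unfolding ziegler_ideal_def ziegler_degrees_def by blast
    have "set_join C D \<in> deg E"
      unfolding E[symmetric] deg_join_def using mem_deg_self by blast
    then have "set_join C D \<le>\<^sub>Z E" unfolding deg_def ziegler_equiv_def by blast
    then show ?thesis using down J unfolding E by blast
  qed
  show "{C. deg C \<in> I} \<noteq> {}"
    using assms unfolding ziegler_ideal_def ziegler_degrees_def by blast
qed

text \<open>A set equivalent to \<open>D\<close> is \<open>Phi e D\<close> for some of the countably
  many \<open>e\<close>.\<close>

lemma countable_deg_fibre: "countable {C. deg C = x}"
proof (cases "\<exists>D. deg D = x")
  case True
  then obtain D where "deg D = x" by blast
  then have "C \<le>\<^sub>Z D" if "deg C = x" for C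
    using that mem_deg_self[of C] unfolding deg_def ziegler_equiv_def by blast
  then have "{C. deg C = x} \<subseteq> range (\<lambda>e. Phi e D)"
    unfolding ziegler_le_def by blast
  then show ?thesis by (rule countable_subset) simp
qed simp

theorem theorem1p1:
  fixes I :: "nat set set set"
  assumes "ziegler_ideal I" and "countable I"
  shows "\<exists>A B :: nat set. \<forall>C :: nat set. deg C \<in> I \<longleftrightarrow> (C \<le>\<^sub>Z A \<and> C \<le>\<^sub>Z B)"
proof -
  have "{C. deg C \<in> I} = (\<Union>x\<in>I. {C. deg C = x})" by blast
  then have "countable {C. deg C \<in> I}"
    using assms(2) by (simp add: countable_deg_fibre)
  then show ?thesis
    using ziegler_set_ideal.exact_pair[OF ziegler_set_ideal_of_ideal[OF assms(1)]] by simp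
qed

end
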